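(* For all integers $m\ge 0$ and $\lambda\in\mathbb Z$, the following identities hold in $\dot{\mathbf U}$: \[ \mathfrak t_{\mathrm{odd}}^{(2m)}\mathbf 1_{2\lambda-1}= \sum_{c=0}^m \sum_{a=0}^{2m-2c} q^{2(a+c)(m-a-\lambda) -2ac+a -\binom{2c}{2}} \begin{bmatrix} m-c-a-\lambda\\ c\end{bmatrix}_{q^2} E^{(a)} F^{(2m-2c-a)}\mathbf 1_{2\lambda-1}, \] \[ \mathfrak t_{\mathrm{odd}}^{(2m+1)}\mathbf 1_{2\lambda-1}= \sum_{c=0}^{m} \sum_{a=0}^{2m+1-2c} q^{2(a+c)(m-a-\lambda)-2ac+2a -\binom{2c}{2}} \begin{bmatrix} m-c-a-\lambda+1\\ c\end{bmatrix}_{q^2} E^{(a)} F^{(2m+1-2c-a)}\mathbf 1_{2\lambda-1}. \] In particular, $\mathfrak t_{\mathrm{odd}}^{(n)}\mathbf 1_{2\lambda-1}\in {}_{\mathcal A}\dot{\mathbf U}_{\mathrm{odd}}$ for all $n\in\mathbb N$.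
   Context: $\mathbb N=\{0,1,2,\dots\}$, $\mathcal A=\mathbb Z[q,q^{-1}]$. $\mathbf U=\mathbf U_q(\mathfrak{sl}_2)$ is the $\mathbb Q(q)$-algebra generated by $E,F,K,K^{-1}$ with relations $KK^{-1}=K^{-1}K=1$, $EF-FE=\frac{K-K^{-1}}{q-q^{-1}}$, $KE=q^2EK$, $KF=q^{-2}FK$. For $n\in\mathbb Z$, $[n]=\frac{q^n-q^{-n}}{q-q^{-1}}$, $[n]!=[1]\cdots[n]$ for $n\ge 0$; $E^{(n)}=E^n/[n]!$, $F^{(n)}=F^n/[n]!$. For $m\in\mathbb Z$, $b\in\mathbb N$, $\begin{bmatrix} m\\ b\end{bmatrix}_{q^2}=\prod_{1\le i\le b}\frac{q^{2(m-i+1)}-q^{-2(m-i+1)}}{q^{2i}-q^{-2i}}$. In exponents, $\binom{x}{2}=x(x-1)/2$. Put $\check E=q^{-1}EK^{-1}$ and $\mathfrak t=\check E+F$. The $\imath$-divided powers are, for $a\ge 0$, $\mathfrak t_{\mathrm{odd}}^{(2a)}=\frac{1}{[2a]!}\prod_{i=1-a}^{a}(\mathfrak t-[2i-1])$ and $\mathfrak t_{\mathrm{odd}}^{(2a+1)}=\frac{1}{[2a+1]!}\,\mathfrak t\prod_{i=1-a}^{a}(\mathfrak t-[2i-1])$. $\dot{\mathbf U}$ is the modified quantum group: the $\mathbb Q(q)$-algebra generated by $E\mathbf 1_\lambda$, $F\mathbf 1_\lambda$ and idempotents $\mathbf 1_\lambda$ ($\lambda\in\mathbb Z$) with relations $\mathbf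 1_\lambda\mathbf 1_\mu=\delta_{\lambda,\mu}\mathbf 1_\lambda$, $E\mathbf 1_\lambda=\mathbf 1_{\lambda+2}E\mathbf 1_\lambda=\mathbf 1_{\lambda+2}E$, $F\mathbf 1_\lambda=\mathbf 1_{\lambda-2}F\mathbf 1_\lambda=\mathbf 1_{\lambda-2}F$, $EF\mathbf 1_\lambda-FE\mathbf 1_\lambda=[\lambda]\mathbf 1_\lambda$. $\mathbf U$ acts naturally on $\dot{\mathbf U}$ from the left, with $K\mathbf 1_\lambda=q^\lambda\mathbf 1_\lambda$. ${}_{\mathcal A}\dot{\mathbf U}$ is the $\mathcal A$-subalgebra of $\dot{\mathbf U}$ generated by $E^{(n)}\mathbf 1_\lambda$, $F^{(n)}\mathbf 1_\lambda$, $\mathbf 1_\lambda$ ($n\ge 0$, $\lambda\in\mathbb Z$), and ${}_{\mathcal A}\dot{\mathbf U}_{\mathrm{odd}}=\bigoplus_{\lambda\in\mathbb Z}{}_{\mathcal A}\dot{\mathbf U}\,\mathbf 1_{2\lambda-1}$. *)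

theory Defs
  imports "HOL-Computational_Algebra.Computational_Algebra"
begin

section \<open>The field \<open>\<rat>(q)\<close>, quantum integers and binomials\<close>

type_synonym Qq = "rat poly fract"

definition qq :: Qq where
  "qq = Fract [:0, 1:] 1"

definition qint :: "int \<Rightarrow> Qq" where
  "qint n = (qq powi n - qq powi (- n)) / (qq - inverse qq)"

definition qfact :: "nat \<Rightarrow> Qq" where
  "qfact n = (\<Prod>i = 1..n. qint (int i))"

text \<open>The binomial in base \<open>q\<^sup>2\<close>; the upper entry may be negative.\<close>

definition qbinom2 :: "int \<Rightarrow> nat \<Rightarrow> Qq" where
  "qbinom2 m b = (\<Prod>i = 1..b.
     (qq powi (2 * (m - int i + 1)) - qq powi (- (2 * (m - int i + 1))))
       / (qq powi (2 * int i) - qq powi (- (2 * int i))))"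

text \<open>The subring \<open>\<int>[q, q\<^sup>-\<^sup>1]\<close>: integral polynomials in \<open>q\<close> divided by a power of \<open>q\<close>.\<close>

definition laurent_ints :: "Qq set" where
  "laurent_ints = {poly (map_poly of_int p) qq * qq powi k | (p :: int poly) (k :: int). True}"

lemma qq_nonzero [simp]: "qq \<noteq> 0"
  by (simp add: qq_def Zero_fract_def eq_fract)

section \<open>Associative \<open>\<rat>(q)\<close>-algebras by generators and relations\<close>

class Qq_algebra = ring +
  fixes scaleQ :: "Qq \<Rightarrow> 'a \<Rightarrow> 'a" (infixr "*\<^sub>q" 75)
  assumes scaleQ_add_right: "c *\<^sub>q (x + y) = c *\<^sub>q x + c *\<^sub>q y"
    and scaleQ_add_left: "(c + d) *\<^sub>q x = c *\<^sub>q x + d *\<^sub>q x"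
    and scaleQ_scaleQ: "c *\<^sub>q d *\<^sub>q x = (c * d) *\<^sub>q x"
    and scaleQ_one: "1 *\<^sub>q x = x"
    and scaleQ_mult_left: "(c *\<^sub>q x) * y = c *\<^sub>q (x * y)"
    and scaleQ_mult_right: "x * (c *\<^sub>q y) = c *\<^sub>q (x * y)"
begin

lemma scaleQ_zero_left [simp]: "0 *\<^sub>q x = 0"
  using scaleQ_add_left[of 0 0 x] by simp

lemma scaleQ_zero_right [simp]: "c *\<^sub>q 0 = 0"
  using scaleQ_add_right[of c 0 0] by simp

lemma scaleQ_minus_right: "c *\<^sub>q (- x) = - (c *\<^sub>q x)"
  using scaleQ_add_right[of c x "- x"] by (simp add: eq_neg_iff_add_eq_0 add.commute)

lemma scaleQ_diff_left: "(c - d) *\<^sub>q x = c *\<^sub>q x - d *\<^sub>q x"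
  using scaleQ_add_left[of "c - d" d x] by (simp add: eq_diff_eq)

end

text \<open>
  The algebra presented by generators \<open>'g\<close> and relations \<open>R\<close> is the set of formal expressions
  modulo the least congruence that contains \<open>R\<close> and satisfies the axioms of a (not necessarily
  unital) associative \<open>\<rat>(q)\<close>-algebra.
\<close>

datatype 'g expr =
    Gen 'g
  | Zero
  | Plus "'g expr" "'g expr"
  | Neg "'g expr"
  | Scale Qq "'g expr"
  | Times "'g expr" "'g expr"

inductive alg_cong :: "('g expr \<Rightarrow> 'g expr \<Rightarrow> bool) \<Rightarrow> 'g expr \<Rightarrow> 'g expr \<Rightarrow> bool"
  for R where
  rel: "R x y \<Longrightarrow> alg_cong R x y"
| refl: "alg_cong R x x"
| sym: "alg_cong R x y \<Longrightarrow> alg_cong R y x"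
| trans: "alg_cong R x y \<Longrightarrow> alg_cong R y z \<Longrightarrow> alg_cong R x z"
| Plus: "alg_cong R x x' \<Longrightarrow> alg_cong R y y' \<Longrightarrow> alg_cong R (Plus x y) (Plus x' y')"
| Neg: "alg_cong R x x' \<Longrightarrow> alg_cong R (Neg x) (Neg x')"
| Scale: "alg_cong R x x' \<Longrightarrow> alg_cong R (Scale c x) (Scale c x')"
| Times: "alg_cong R x x' \<Longrightarrow> alg_cong R y y' \<Longrightarrow> alg_cong R (Times x y) (Times x' y')"
| plus_assoc: "alg_cong R (Plus (Plus x y) z) (Plus x (Plus y z))"
| plus_comm: "alg_cong R (Plus x y) (Plus y x)"
| plus_zero: "alg_cong R (Plus Zero x) x"
| plus_neg: "alg_cong R (Plus (Neg x) x) Zero"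
| scale_plus: "alg_cong R (Scale c (Plus x y)) (Plus (Scale c x) (Scale c y))"
| plus_scale: "alg_cong R (Scale (c + d) x) (Plus (Scale c x) (Scale d x))"
| scale_scale: "alg_cong R (Scale c (Scale d x)) (Scale (c * d) x)"
| scale_one: "alg_cong R (Scale 1 x) x"
| times_assoc: "alg_cong R (Times (Times x y) z) (Times x (Times y z))"
| times_plus: "alg_cong R (Times x (Plus y z)) (Plus (Times x y) (Times x z))"
| plus_times: "alg_cong R (Times (Plus x y) z) (Plus (Times x z) (Times y z))"
| scale_times: "alg_cong R (Times (Scale c x) y) (Scale c (Times x y))"
| times_scale: "alg_cong R (Times x (Scale c y)) (Scale c (Times x y))"

lemma equivp_alg_cong: "equivp (alg_cong R)"
  by (intro equivpI reflpI sympI transpI) (blast intro: alg_cong.intros)+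

section \<open>The quantum group \<open>U\<^sub>q(sl\<^sub>2)\<close>\<close>

text \<open>
  Expressions carry no unit of their own, so the unit of \<open>U\<close> is a generator subject to the unit laws.
\<close>

datatype U_gen = UOne | UE | UF | UK | UKinv

inductive U_rel :: "U_gen expr \<Rightarrow> U_gen expr \<Rightarrow> bool" where
  "U_rel (Times (Gen UOne) x) x"
| "U_rel (Times x (Gen UOne)) x"
| "U_rel (Times (Gen UK) (Gen UKinv)) (Gen UOne)"
| "U_rel (Times (Gen UKinv) (Gen UK)) (Gen UOne)"
| "U_rel (Plus (Times (Gen UE) (Gen UF)) (Neg (Times (Gen UF) (Gen UE))))
     (Scale (1 / (qq - inverse qq)) (Plus (Gen UK) (Neg (Gen UKinv))))"
| "U_rel (Times (Gen UK) (Gen UE)) (Scale (qq powi 2) (Times (Gen UE) (Gen UK)))"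
| "U_rel (Times (Gen UK) (Gen UF)) (Scale (qq powi (- 2)) (Times (Gen UF) (Gen UK)))"

quotient_type U = "U_gen expr" / "alg_cong U_rel"
  by (rule equivp_alg_cong)

primrec counit_expr :: "U_gen expr \<Rightarrow> Qq" where
  "counit_expr (Gen g) = (if g = UE \<or> g = UF then 0 else 1)"
| "counit_expr Zero = 0"
| "counit_expr (Plus x y) = counit_expr x + counit_expr y"
| "counit_expr (Neg x) = - counit_expr x"
| "counit_expr (Scale c x) = c * counit_expr x"
| "counit_expr (Times x y) = counit_expr x * counit_expr y"

lemma counit_expr_cong: "alg_cong U_rel x y \<Longrightarrow> counit_expr x = counit_expr y"
  by (induction rule: alg_cong.induct) (auto simp: algebra_simps elim: U_rel.cases)

instantiation U :: "{Qq_algebra, ring_1}"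
begin

lift_definition zero_U :: U is Zero .
lift_definition one_U :: U is "Gen UOne" .
lift_definition plus_U :: "U \<Rightarrow> U \<Rightarrow> U" is Plus by (rule alg_cong.Plus)
lift_definition uminus_U :: "U \<Rightarrow> U" is Neg by (rule alg_cong.Neg)
lift_definition times_U :: "U \<Rightarrow> U \<Rightarrow> U" is Times by (rule alg_cong.Times)
lift_definition scaleQ_U :: "Qq \<Rightarrow> U \<Rightarrow> U" is Scale by (rule alg_cong.Scale)
definition minus_U :: "U \<Rightarrow> U \<Rightarrow> U" where "minus_U x y = x + - y"

instance
proof
  fix x y z :: U and c d :: Qq
  show "x + y + z = x + (y + z)" by transfer (rule alg_cong.plus_assoc)
  show "x + y = y + x" by transfer (rule alg_cong.plus_comm)
  show "0 + x = x" by transfer (rule alg_cong.plus_zero)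
  show "- x + x = 0" by transfer (rule alg_cong.plus_neg)
  show "x - y = x + - y" by (rule minus_U_def)
  show "x * y * z = x * (y * z)" by transfer (rule alg_cong.times_assoc)
  show "(x + y) * z = x * z + y * z" by transfer (rule alg_cong.plus_times)
  show "x * (y + z) = x * y + x * z" by transfer (rule alg_cong.times_plus)
  show "1 * x = x" by transfer (intro alg_cong.rel U_rel.intros)
  show "x * 1 = x" by transfer (intro alg_cong.rel U_rel.intros)
  show "(0 :: U) \<noteq> 1" by transfer (auto dest: counit_expr_cong)
  show "c *\<^sub>q (x + y) = c *\<^sub>q x + c *\<^sub>q y" by transfer (rule alg_cong.scale_plus)
  show "(c + d) *\<^sub>q x = c *\<^sub>q x + d *\<^sub>q x" by transfer (rule alg_cong.plus_scale)
  show "c *\<^sub>q d *\<^sub>q x = (c * d) *\<^sub>q x" by transfer (rule alg_cong.scale_scale)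
  show "1 *\<^sub>q x = x" by transfer (rule alg_cong.scale_one)
  show "(c *\<^sub>q x) * y = c *\<^sub>q (x * y)" by transfer (rule alg_cong.scale_times)
  show "x * (c *\<^sub>q y) = c *\<^sub>q (x * y)" by transfer (rule alg_cong.times_scale)
qed

end

lift_definition E :: U is "Gen UE" .
lift_definition F :: U is "Gen UF" .
lift_definition K :: U is "Gen UK" .
lift_definition Kinv :: U is "Gen UKinv" .

lemma U_relations:
  "K * Kinv = 1" "Kinv * K = 1"
  "E * F - F * E = (1 / (qq - inverse qq)) *\<^sub>q (K - Kinv)"
  "K * E = qq powi 2 *\<^sub>q (E * K)"
  "K * F = qq powi (- 2) *\<^sub>q (F * K)"
  unfolding minus_U_def
  subgoal by transfer (intro alg_cong.rel U_rel.intros)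
  subgoal by transfer (intro alg_cong.rel U_rel.intros)
  subgoal by transfer (intro alg_cong.rel U_rel.intros)
  subgoal by transfer (intro alg_cong.rel U_rel.intros)
  subgoal by transfer (intro alg_cong.rel U_rel.intros)
  done

definition divE :: "nat \<Rightarrow> U" where
  "divE n = (1 / qfact n) *\<^sub>q E ^ n"

definition divF :: "nat \<Rightarrow> U" where
  "divF n = (1 / qfact n) *\<^sub>q F ^ n"

definition Echeck :: U where
  "Echeck = inverse qq *\<^sub>q (E * Kinv)"

definition tt :: U where
  "tt = Echeck + F"

text \<open>The factors below commute, so the order chosen in the list product is irrelevant.\<close>

definition tt_prod :: "nat \<Rightarrow> U" where
  "tt_prod a = prod_list (map (\<lambda>i. tt - qint (2 * i - 1) *\<^sub>q 1) [1 - int a .. int a])"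

definition idiv_odd :: "nat \<Rightarrow> U" where
  "idiv_odd n = (let a = n div 2 in
     if even n then (1 / qfact n) *\<^sub>q tt_prod a
     else (1 / qfact n) *\<^sub>q (tt * tt_prod a))"

lemma idiv_odd_even: "idiv_odd (2 * a) = (1 / qfact (2 * a)) *\<^sub>q tt_prod a"
  and idiv_odd_odd: "idiv_odd (2 * a + 1) = (1 / qfact (2 * a + 1)) *\<^sub>q (tt * tt_prod a)"
  by (simp_all add: idiv_odd_def)

section \<open>The modified quantum group\<close>

datatype dU_gen = DOne int | DE int | DF int

text \<open>
  \<open>DE l\<close> and \<open>DF l\<close> stand for the single symbols \<open>E1\<^sub>l\<close> and \<open>F1\<^sub>l\<close>, which the notation takes to be
  fixed by right multiplication with \<open>1\<^sub>l\<close>. The word \<open>EF1\<^sub>l\<close> is \<open>(E1\<^sub>l\<^sub>-\<^sub>2)(F1\<^sub>l)\<close>.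
\<close>

inductive dU_rel :: "dU_gen expr \<Rightarrow> dU_gen expr \<Rightarrow> bool" where
  "dU_rel (Times (Gen (DOne l)) (Gen (DOne m))) (if l = m then Gen (DOne l) else Zero)"
| "dU_rel (Times (Gen (DE l)) (Gen (DOne l))) (Gen (DE l))"
| "dU_rel (Times (Gen (DOne (l + 2))) (Gen (DE l))) (Gen (DE l))"
| "dU_rel (Times (Gen (DF l)) (Gen (DOne l))) (Gen (DF l))"
| "dU_rel (Times (Gen (DOne (l - 2))) (Gen (DF l))) (Gen (DF l))"
| "dU_rel (Plus (Times (Gen (DE (l - 2))) (Gen (DF l))) (Neg (Times (Gen (DF (l + 2))) (Gen (DE l)))))
     (Scale (qint l) (Gen (DOne l)))"

quotient_type dU = "dU_gen expr" / "alg_cong dU_rel"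
  by (rule equivp_alg_cong)

instantiation dU :: Qq_algebra
begin

lift_definition zero_dU :: dU is Zero .
lift_definition plus_dU :: "dU \<Rightarrow> dU \<Rightarrow> dU" is Plus by (rule alg_cong.Plus)
lift_definition uminus_dU :: "dU \<Rightarrow> dU" is Neg by (rule alg_cong.Neg)
lift_definition times_dU :: "dU \<Rightarrow> dU \<Rightarrow> dU" is Times by (rule alg_cong.Times)
lift_definition scaleQ_dU :: "Qq \<Rightarrow> dU \<Rightarrow> dU" is Scale by (rule alg_cong.Scale)
definition minus_dU :: "dU \<Rightarrow> dU \<Rightarrow> dU" where "minus_dU x y = x + - y"

instance
proof
  fix x y z :: dU and c d :: Qq
  show "x + y + z = x + (y + z)" by transfer (rule alg_cong.plus_assoc)
  show "x + y = y + x" by transfer (rule alg_cong.plus_comm)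
  show "0 + x = x" by transfer (rule alg_cong.plus_zero)
  show "- x + x = 0" by transfer (rule alg_cong.plus_neg)
  show "x - y = x + - y" by (rule minus_dU_def)
  show "x * y * z = x * (y * z)" by transfer (rule alg_cong.times_assoc)
  show "(x + y) * z = x * z + y * z" by transfer (rule alg_cong.plus_times)
  show "x * (y + z) = x * y + x * z" by transfer (rule alg_cong.times_plus)
  show "c *\<^sub>q (x + y) = c *\<^sub>q x + c *\<^sub>q y" by transfer (rule alg_cong.scale_plus)
  show "(c + d) *\<^sub>q x = c *\<^sub>q x + d *\<^sub>q x" by transfer (rule alg_cong.plus_scale)
  show "c *\<^sub>q d *\<^sub>q x = (c * d) *\<^sub>q x" by transfer (rule alg_cong.scale_scale)
  show "1 *\<^sub>q x = x" by transfer (rule alg_cong.scale_one)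
  show "(c *\<^sub>q x) * y = c *\<^sub>q (x * y)" by transfer (rule alg_cong.scale_times)
  show "x * (c *\<^sub>q y) = c *\<^sub>q (x * y)" by transfer (rule alg_cong.times_scale)
qed

end

lift_definition dgen :: "dU_gen \<Rightarrow> dU" is Gen .

abbreviation idem :: "int \<Rightarrow> dU" where "idem l \<equiv> dgen (DOne l)"

lemma dU_relations:
  "idem l * idem m = (if l = m then idem l else 0)"
  "dgen (DE l) * idem l = dgen (DE l)"
  "idem (l + 2) * dgen (DE l) = dgen (DE l)"
  "dgen (DF l) * idem l = dgen (DF l)"
  "idem (l - 2) * dgen (DF l) = dgen (DF l)"
  "dgen (DE (l - 2)) * dgen (DF l) - dgen (DF (l + 2)) * dgen (DE l) = qint l *\<^sub>q idem l"
  unfolding minus_dU_def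
  subgoal
  proof -
    have "alg_cong dU_rel (Times (Gen (DOne l)) (Gen (DOne m))) (if l = m then Gen (DOne l) else Zero)"
      by (intro alg_cong.rel dU_rel.intros)
    then show ?thesis
      by (cases "l = m") (simp_all, (transfer, simp)+)
  qed
  subgoal by transfer (intro alg_cong.rel dU_rel.intros)
  subgoal by transfer (intro alg_cong.rel dU_rel.intros)
  subgoal by transfer (intro alg_cong.rel dU_rel.intros)
  subgoal by transfer (intro alg_cong.rel dU_rel.intros)
  subgoal by transfer (intro alg_cong.rel dU_rel.intros)
  done

lemma dU_induct [case_names gen zero plus neg scale times]:
  assumes "\<And>g. P (dgen g)" "P 0" "\<And>x y. P x \<Longrightarrow> P y \<Longrightarrow> P (x + y)" "\<And>x. P x \<Longrightarrow> P (- x)"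
    "\<And>c x. P x \<Longrightarrow> P (c *\<^sub>q x)" "\<And>x y. P x \<Longrightarrow> P y \<Longrightarrow> P (x * y)"
  shows "P x"
proof (induction x rule: dU.abs_induct)
  case (1 e)
  show ?case
    by (induction e)
      (use assms in \<open>simp_all flip: dgen.abs_eq zero_dU.abs_eq plus_dU.abs_eq uminus_dU.abs_eq
        scaleQ_dU.abs_eq times_dU.abs_eq\<close>)
qed

section \<open>The left action of \<open>U\<close> on the modified quantum group\<close>

text \<open>
  For a family \<open>a\<^sub>l\<close> with \<open>a\<^sub>l = a\<^sub>l 1\<^sub>l\<close>, \<open>lmul a\<close> is left multiplication with the formal
  (possibly infinite) sum \<open>\<Sum>\<^sub>l a\<^sub>l\<close>: on \<open>1\<^sub>l x\<close> it is left multiplication with \<open>a\<^sub>l\<close>.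
\<close>

fun target :: "dU_gen \<Rightarrow> int" where
  "target (DOne l) = l"
| "target (DE l) = l + 2"
| "target (DF l) = l - 2"

primrec lmul_expr :: "(int \<Rightarrow> dU) \<Rightarrow> dU_gen expr \<Rightarrow> dU" where
  "lmul_expr a (Gen g) = a (target g) * dgen g"
| "lmul_expr a Zero = 0"
| "lmul_expr a (Plus x y) = lmul_expr a x + lmul_expr a y"
| "lmul_expr a (Neg x) = - lmul_expr a x"
| "lmul_expr a (Scale c x) = c *\<^sub>q lmul_expr a x"
| "lmul_expr a (Times x y) = lmul_expr a x * abs_dU y"

lemma lmul_expr_cong:
  assumes "alg_cong dU_rel x y"
  shows "lmul_expr a x = lmul_expr a y"
  using assms
proof (induction rule: alg_cong.induct)
  case (rel x y)
  have EF: "a l * dgen (DE (l - 2)) * dgen (DF l) - a l * dgen (DF (l + 2)) * dgen (DE l)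
      = qint l *\<^sub>q (a l * idem l)" for l
    using dU_relations(6)[of l]
    by (metis mult.assoc right_diff_distrib scaleQ_mult_right)
  show ?case
    using rel
    by (cases rule: dU_rel.cases)
      (simp_all add: dU_relations mult.assoc EF[simplified mult.assoc] flip: dgen.abs_eq)
next
  case (Times x x' y y')
  moreover have "abs_dU y = abs_dU y'"
    using Times by (simp add: dU.abs_eq_iff)
  ultimately show ?case by simp
qed (simp_all add: algebra_simps scaleQ_add_right scaleQ_add_left scaleQ_scaleQ scaleQ_one
    scaleQ_mult_left scaleQ_mult_right
    flip: plus_dU.abs_eq scaleQ_dU.abs_eq times_dU.abs_eq)

lift_definition lmul :: "(int \<Rightarrow> dU) \<Rightarrow> dU \<Rightarrow> dU" is lmul_expr
  by (rule lmul_expr_cong)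

lemma lmul_simps [simp]:
  "lmul a (dgen g) = a (target g) * dgen g"
  "lmul a 0 = 0"
  "lmul a (x + y) = lmul a x + lmul a y"
  "lmul a (- x) = - lmul a x"
  "lmul a (c *\<^sub>q x) = c *\<^sub>q lmul a x"
  "lmul a (x * y) = lmul a x * y"
  subgoal by transfer simp
  subgoal by transfer simp
  subgoal by transfer simp
  subgoal by transfer simp
  subgoal by transfer simp
  subgoal by (induction y) (transfer; simp)
  done

primrec gen_act :: "U_gen \<Rightarrow> dU \<Rightarrow> dU" where
  "gen_act UOne = id"
| "gen_act UE = lmul (\<lambda>l. dgen (DE l))"
| "gen_act UF = lmul (\<lambda>l. dgen (DF l))"
| "gen_act UK = lmul (\<lambda>l. qq powi l *\<^sub>q idem l)"
| "gen_act UKinv = lmul (\<lambda>l. qq powi (- l) *\<^sub>q idem l)"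

primrec act_expr :: "U_gen expr \<Rightarrow> dU \<Rightarrow> dU" where
  "act_expr (Gen g) v = gen_act g v"
| "act_expr Zero v = 0"
| "act_expr (Plus x y) v = act_expr x v + act_expr y v"
| "act_expr (Neg x) v = - act_expr x v"
| "act_expr (Scale c x) v = c *\<^sub>q act_expr x v"
| "act_expr (Times x y) v = act_expr x (act_expr y v)"

lemma gen_act_linear [simp]:
  "gen_act g (v + w) = gen_act g v + gen_act g w"
  "gen_act g (- v) = - gen_act g v"
  "gen_act g (c *\<^sub>q v) = c *\<^sub>q gen_act g v"
  "gen_act g (v * w) = gen_act g v * w"
  "gen_act g 0 = 0"
  by (cases g; simp)+

lemma act_expr_linear [simp]:
  "act_expr x (v + w) = act_expr x v + act_expr x w"
  "act_expr x (- v) = - act_expr x v"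
  "act_expr x (c *\<^sub>q v) = c *\<^sub>q act_expr x v"
  "act_expr x (v * w) = act_expr x v * w"
  "act_expr x 0 = 0"
  by (induction x arbitrary: v w)
    (simp_all add: scaleQ_add_right scaleQ_minus_right scaleQ_scaleQ scaleQ_mult_left
      distrib_right mult.commute)

lemma idem_target [simp]: "idem (target g) * dgen g = dgen g"
  by (cases g) (simp_all add: dU_relations)

lemma idem_target_mult [simp]: "idem (target g) * (dgen g * x) = dgen g * x"
  by (simp flip: mult.assoc)

lemma act_expr_cong:
  assumes "alg_cong U_rel x y"
  shows "act_expr x v = act_expr y v"
  using assms
proof (induction arbitrary: v rule: alg_cong.induct)
  case (rel x y)
  show ?case
  proof (induction v rule: dU_induct)
    case (gen g)
    let ?l = "target g"
    have on_idem: "act_expr x (idem l) = act_expr y (idem l)" for l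
      using rel
    proof (cases rule: U_rel.cases)
      case 5
      have "qint l *\<^sub>q idem l
          = (1 / (qq - inverse qq)) *\<^sub>q (qq powi l *\<^sub>q idem l + - (qq powi (- l) *\<^sub>q idem l))"
        by (simp add: qint_def scaleQ_scaleQ flip: scaleQ_diff_left)
      then show ?thesis
        using dU_relations(6)[of l] 5 by (simp add: dU_relations scaleQ_mult_left)
    qed (simp_all add: dU_relations scaleQ_scaleQ scaleQ_mult_left scaleQ_one power_int_add
        power_int_minus power_int_diff field_simps)
    have "act_expr x (idem ?l * dgen g) = act_expr y (idem ?l * dgen g)"
      by (simp only: act_expr_linear on_idem)
    then show ?case by simp
  qed simp_all
qed (simp_all add: algebra_simps scaleQ_add_right scaleQ_add_left scaleQ_scaleQ scaleQ_one)

lift_definition act :: "U \<Rightarrow> dU \<Rightarrow> dU" (infixr "\<rhd>" 70) is act_expr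
  by (rule ext) (rule act_expr_cong)

text \<open>
  This is a unital left module structure commuting with right multiplication. As the elements
  \<open>1\<^sub>l\<close> generate \<open>dU\<close> under right multiplication and addition, \<open>act_module\<close> and
  \<open>act_idem\<close> determine it.
\<close>

lemma act_module:
  "1 \<rhd> v = v"
  "(x * y) \<rhd> v = x \<rhd> y \<rhd> v"
  "(x + y) \<rhd> v = x \<rhd> v + y \<rhd> v"
  "(c *\<^sub>q x) \<rhd> v = c *\<^sub>q (x \<rhd> v)"
  "x \<rhd> (v + w) = x \<rhd> v + x \<rhd> w"
  "x \<rhd> (c *\<^sub>q v) = c *\<^sub>q (x \<rhd> v)"
  "x \<rhd> (v * w) = (x \<rhd> v) * w"
  by (transfer; simp)+

lemma act_idem:
  "E \<rhd> idem l = dgen (DE l)"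
  "F \<rhd> idem l = dgen (DF l)"
  "K \<rhd> idem l = qq powi l *\<^sub>q idem l"
  "Kinv \<rhd> idem l = qq powi (- l) *\<^sub>q idem l"
  by (transfer; simp add: dU_relations scaleQ_mult_left)+

section \<open>The integral form\<close>

inductive_set AdU :: "dU set" where
  idem: "idem l \<in> AdU"
| divE: "divE n \<rhd> idem l \<in> AdU"
| divF: "divF n \<rhd> idem l \<in> AdU"
| zero: "0 \<in> AdU"
| plus: "x \<in> AdU \<Longrightarrow> y \<in> AdU \<Longrightarrow> x + y \<in> AdU"
| scale: "c \<in> laurent_ints \<Longrightarrow> x \<in> AdU \<Longrightarrow> c *\<^sub>q x \<in> AdU"
| times: "x \<in> AdU \<Longrightarrow> y \<in> AdU \<Longrightarrow> x * y \<in> AdU"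

text \<open>
  The direct sum is the internal one: the sum of the subspaces is direct by \<open>AdU_odd_direct\<close>.
\<close>

definition AdU_odd :: "dU set" where
  "AdU_odd = {\<Sum>l\<in>S. x l * idem (2 * l - 1) | (S :: int set) x. finite S \<and> (\<forall>l\<in>S. x l \<in> AdU)}"

lemma AdU_odd_direct:
  assumes "finite S" "(\<Sum>l\<in>S. x l * idem (2 * l - 1)) = 0" "k \<in> S"
  shows "x k * idem (2 * k - 1) = 0"
proof -
  have "0 = (\<Sum>l\<in>S. x l * idem (2 * l - 1)) * idem (2 * k - 1)"
    using assms(2) by simp
  also have "\<dots> = (\<Sum>l\<in>S. if l = k then x k * idem (2 * k - 1) else 0)"
    unfolding sum_distrib_right by (rule sum.cong) (auto simp: mult.assoc dU_relations(1))
  also have "\<dots> = x k * idem (2 * k - 1)"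
    using assms by simp
  finally show ?thesis by simp
qed

end

theory Submission
  imports Defs
begin

text \<open>
  The proof is an induction along the two recursions
  \<open>t t\<^sup>(\<^sup>2\<^sup>m\<^sup>) = [2m+1] t\<^sup>(\<^sup>2\<^sup>m\<^sup>+\<^sup>1\<^sup>)\<close> and
  \<open>t t\<^sup>(\<^sup>2\<^sup>m\<^sup>+\<^sup>1\<^sup>) = [2m+2] t\<^sup>(\<^sup>2\<^sup>m\<^sup>+\<^sup>2\<^sup>) + [2m+1] t\<^sup>(\<^sup>2\<^sup>m\<^sup>)\<close>
  (\<open>tt_idiv_odd_even\<close>, \<open>tt_idiv_odd_odd\<close>). They determine all the i-divided powers, because
  \<open>[n]\<close> is invertible in \<open>\<rat>(q)\<close> for \<open>n > 0\<close>. It therefore suffices that the claimed sums satisfy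
  the same recursions.

  Write \<open>v(a,b) = E\<^sup>(\<^sup>a\<^sup>) F\<^sup>(\<^sup>b\<^sup>) 1\<^sub>w\<close>. Moving \<open>F\<close> past \<open>E\<^sup>(\<^sup>a\<^sup>)\<close> on a weight vector shows that \<open>t\<close> maps
  \<open>v(a,b)\<close> to a combination of \<open>v(a+1,b)\<close>, \<open>v(a,b+1)\<close> and \<open>v(a-1,b)\<close> (\<open>tt_EF_vec\<close>). Hence \<open>t\<close> maps
  a sum \<open>\<Sum> f(c,a) v(a, n-2c-a)\<close> to a sum of the same shape with \<open>n+1\<close> in place of \<open>n\<close>
  (\<open>tt_EF_sum\<close>), and the recursions become identities between coefficients.

  In such an identity all \<open>q\<^sup>2\<close>-binomials are among \<open>[N; c]\<close>, \<open>[N-1; c]\<close> and \<open>[N-1; c-1]\<close> for one \<open>N\<close>.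
  For \<open>c > 0\<close> the first two are rational multiples of the third, so after clearing denominators
  there remains an identity between Laurent polynomials in \<open>q\<close> with symbolic exponents, which
  is checked by expansion (\<open>odd_binom_identity\<close>, \<open>even_binom_identity\<close>).

  Integrality follows from the expansion: the \<open>q\<^sup>2\<close>-binomials lie in \<open>\<int>[q, q\<^sup>-\<^sup>1]\<close> by the Pascal
  recursion, used upwards and downwards in the upper entry, and \<open>v(a,b)\<close> is a product of
  two generators of the integral form.
\<close>

section \<open>Quantum integers and binomials\<close>

lemma qq_power_eq: "qq ^ n = Fract (monom 1 n) 1"
  by (induction n) (simp_all add: qq_def One_fract_def monom_Suc mult_fract flip: monom_0)

lemma qq_power_neq_1: "n > 0 \<Longrightarrow> qq ^ n \<noteq> 1"
  by (auto simp: qq_power_eq One_fract_def eq_fract monom_eq_1_iff)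

lemma powi_mult:
  "qq powi i * qq powi j = qq powi (i + j)"
  "qq powi i * (qq powi j * x) = qq powi (i + j) * x"
  by (simp_all add: power_int_add)

lemma inverse_qq: "inverse qq = qq powi (- 1)"
  by (simp add: power_int_minus)

text \<open>
  The numerator of \<open>[n]\<close>. All scalar identities are stated with \<open>qdiff\<close>, because products of such
  differences expand into sums of powers of \<open>q\<close>.
\<close>

definition qdiff :: "int \<Rightarrow> Qq" where
  "qdiff n = qq powi n - qq powi (- n)"

lemma qdiff_0 [simp]: "qdiff 0 = 0"
  by (simp add: qdiff_def)

lemma qdiff_minus: "qdiff (- n) = - qdiff n"
  by (simp add: qdiff_def)

lemma qdiff_nonzero:
  assumes "n > 0"
  shows "qdiff n \<noteq> 0"
proof
  assume "qdiff n = 0"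
  then have "qq powi n * qq powi n = qq powi n * qq powi (- n)"
    by (simp add: qdiff_def)
  then have "qq powi (n + n) = 1"
    by (simp add: powi_mult)
  then have "qq ^ nat (n + n) = 1"
    using assms by (simp add: power_int_def)
  then show False
    using qq_power_neq_1[of "nat (n + n)"] assms by simp
qed

lemma qint_qdiff: "qint n = qdiff n / qdiff 1"
  by (simp add: qint_def qdiff_def power_int_minus)

lemma qint_nonzero: "n > 0 \<Longrightarrow> qint n \<noteq> 0"
  by (simp add: qint_qdiff qdiff_nonzero)

lemma qint_0 [simp]: "qint 0 = 0"
  by (simp add: qint_qdiff)

lemma qint_minus: "qint (- n) = - qint n"
  by (simp add: qint_qdiff qdiff_minus)

lemma qfact_0 [simp]: "qfact 0 = 1"
  by (simp add: qfact_def)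

lemma qfact_Suc: "qfact (Suc n) = qint (int (Suc n)) * qfact n"
  by (simp add: qfact_def mult.commute)

lemma qfact_nonzero [simp]: "qfact n \<noteq> 0"
  by (simp add: qfact_def qint_nonzero)

lemma qdiff_mult: "qdiff x * qdiff y =
    qq powi (x + y) - qq powi (x - y) - qq powi (y - x) + qq powi (- x - y)"
  by (simp add: qdiff_def algebra_simps powi_mult)

lemma qbinom2_0 [simp]: "qbinom2 m 0 = 1"
  by (simp add: qbinom2_def)

lemma qbinom2_qdiff:
  "qbinom2 m b = (\<Prod>i = 1..b. qdiff (2 * (m - int i + 1)) / qdiff (2 * int i))"
  by (simp add: qbinom2_def qdiff_def)

text \<open>
  The next two lemmas express \<open>[m; b+1]\<close> and \<open>[m+1; b+1]\<close> through \<open>[m; b]\<close>, free of denominators.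
\<close>

lemma qbinom2_Suc_lower:
  "qdiff (2 * int (Suc b)) * qbinom2 m (Suc b) = qdiff (2 * (m - int b)) * qbinom2 m b"
  using qdiff_nonzero[of "2 * int (Suc b)"] by (simp add: qbinom2_qdiff)

lemma qbinom2_absorb:
  "qdiff (2 * int (Suc b)) * qbinom2 (m + 1) (Suc b) = qdiff (2 * (m + 1)) * qbinom2 m b"
proof (induction b)
  case 0
  show ?case using qdiff_nonzero[of 2] by (simp add: qbinom2_qdiff)
next
  case (Suc b)
  have nz: "qdiff (2 * int (Suc b)) \<noteq> 0" by (simp add: qdiff_nonzero)
  have "qdiff (2 * int (Suc b)) * (qdiff (2 * int (Suc (Suc b))) * qbinom2 (m + 1) (Suc (Suc b)))
      = qdiff (2 * (m - int b)) * (qdiff (2 * int (Suc b)) * qbinom2 (m + 1) (Suc b))"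
    by (subst qbinom2_Suc_lower) (simp add: algebra_simps)
  also have "\<dots> = qdiff (2 * (m + 1)) * (qdiff (2 * (m - int b)) * qbinom2 m b)"
    by (simp only: Suc mult.left_commute)
  also have "\<dots> = qdiff (2 * int (Suc b)) * (qdiff (2 * (m + 1)) * qbinom2 m (Suc b))"
    by (simp only: mult.left_commute flip: qbinom2_Suc_lower)
  finally show ?case using nz by simp
qed

lemma qbinom2_pascal:
  "qbinom2 (m + 1) (Suc b) = qq powi (2 * int (Suc b)) * qbinom2 m (Suc b)
     + qq powi (2 * (int b - m)) * qbinom2 m b"
proof -
  have nz: "qdiff (2 * int (Suc b)) \<noteq> 0" by (simp add: qdiff_nonzero)
  have *: "qdiff (2 * (m + 1)) = qq powi (2 * int (Suc b)) * qdiff (2 * (m - int b))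
      + qq powi (2 * (int b - m)) * qdiff (2 * int (Suc b))"
    by (simp add: qdiff_def algebra_simps powi_mult)
  have "qdiff (2 * int (Suc b)) * qbinom2 (m + 1) (Suc b)
     = qq powi (2 * int (Suc b)) * (qdiff (2 * int (Suc b)) * qbinom2 m (Suc b))
      + qq powi (2 * (int b - m)) * qdiff (2 * int (Suc b)) * qbinom2 m b"
    unfolding qbinom2_absorb * unfolding qbinom2_Suc_lower by (simp only: distrib_right mult.assoc)
  also have "\<dots> = qdiff (2 * int (Suc b)) * (qq powi (2 * int (Suc b)) * qbinom2 m (Suc b)
     + qq powi (2 * (int b - m)) * qbinom2 m b)"
    by (simp add: algebra_simps)
  finally show ?thesis using nz by simp
qed

section \<open>Integrality of the binomials\<close>

lemma laurent_ints_powi: "qq powi k \<in> laurent_ints"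
  unfolding laurent_ints_def by (rule CollectI, rule exI[of _ 1], rule exI[of _ k]) simp

lemma laurent_ints_0: "0 \<in> laurent_ints"
  unfolding laurent_ints_def by (rule CollectI, rule exI[of _ 0], rule exI[of _ 0]) simp

lemma laurent_ints_powi_mult:
  assumes "x \<in> laurent_ints"
  shows "qq powi k * x \<in> laurent_ints"
proof -
  obtain p j where "x = poly (map_poly of_int p) qq * qq powi j"
    using assms by (auto simp: laurent_ints_def)
  then have "qq powi k * x = poly (map_poly of_int p) qq * qq powi (k + j)"
    by (simp add: power_int_add)
  then show ?thesis unfolding laurent_ints_def by blast
qed

text \<open>Lowering the exponent of \<open>q\<close> brings two elements to a common denominator.\<close>

lemma laurent_ints_common_exponent:
  assumes "x = poly (map_poly of_int p) qq * qq powi j" "k \<le> j"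
  obtains r :: "int poly" where "x = poly (map_poly of_int r) qq * qq powi k"
proof
  have *: "map_poly of_int (monom 1 n * p) = monom 1 n * (map_poly of_int p :: Qq poly)" for n
    by (rule poly_eqI) (simp add: coeff_map_poly coeff_monom_mult)
  show "x = poly (map_poly of_int (monom 1 (nat (j - k)) * p)) qq * qq powi k"
    using assms by (simp add: * poly_monom power_int_diff power_int_def[of _ "j - k", symmetric]
        flip: power_int_of_nat)
qed

lemma laurent_ints_diff:
  assumes "x \<in> laurent_ints" "y \<in> laurent_ints"
  shows "x - y \<in> laurent_ints"
proof -
  obtain p j p' j' where x: "x = poly (map_poly of_int p) qq * qq powi j"
    and y: "y = poly (map_poly of_int p') qq * qq powi j'"
    using assms by (auto simp: laurent_ints_def)
  obtain r r' :: "int poly" where "x = poly (map_poly of_int r) qq * qq powi (min j j')"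
    "y = poly (map_poly of_int r') qq * qq powi (min j j')"
    using laurent_ints_common_exponent[OF x, of "min j j'"]
      laurent_ints_common_exponent[OF y, of "min j j'"] by (metis min.cobounded1 min.cobounded2)
  moreover have "map_poly of_int (r - r') = (map_poly of_int r - map_poly of_int r' :: Qq poly)"
    by (rule poly_eqI) (simp add: coeff_map_poly)
  ultimately have "x - y = poly (map_poly of_int (r - r')) qq * qq powi (min j j')"
    by (simp add: left_diff_distrib)
  then show ?thesis unfolding laurent_ints_def by blast
qed

lemma laurent_ints_add:
  assumes "x \<in> laurent_ints" "y \<in> laurent_ints"
  shows "x + y \<in> laurent_ints"
  using laurent_ints_diff[OF assms(1) laurent_ints_diff[OF laurent_ints_0 assms(2)]] by simp

text \<open>
  The upper entry may be negative, so the inner induction departs from \<open>0\<close> in both directions. Downwards,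
  the Pascal recursion is solved for \<open>[m; b+1]\<close>, whose factor is a unit of \<open>\<int>[q, q\<^sup>-\<^sup>1]\<close>.
\<close>

lemma qbinom2_laurent_ints: "qbinom2 m b \<in> laurent_ints"
proof (induction b arbitrary: m)
  case 0
  show ?case using laurent_ints_powi[of 0] by simp
next
  case (Suc b)
  show ?case
  proof (induction m rule: int_induct[where k = 0])
    case base
    have "qbinom2 0 (Suc b) = 0"
      unfolding qbinom2_qdiff by (rule prod_zero) (auto intro!: bexI[of _ 1])
    then show ?case by (simp add: laurent_ints_0)
  next
    case (step1 i)
    then show ?case
      unfolding qbinom2_pascal by (intro laurent_ints_add laurent_ints_powi_mult Suc.IH)
  next
    case (step2 i)
    have "qbinom2 (i - 1) (Suc b) = qq powi (- (2 * int (Suc b))) *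
       (qbinom2 i (Suc b) - qq powi (2 * (int b - (i - 1))) * qbinom2 (i - 1) b)"
      using qbinom2_pascal[of "i - 1" b] by (simp add: powi_mult)
    then show ?case
      using step2 by (auto intro!: laurent_ints_diff laurent_ints_powi_mult Suc.IH)
  qed
qed

section \<open>The coefficients and their recursions\<close>

definition even_coeff :: "int \<Rightarrow> nat \<Rightarrow> nat \<Rightarrow> nat \<Rightarrow> Qq" where
  "even_coeff l m c a =
     qq powi (2 * (int a + int c) * (int m - int a - l) - 2 * int a * int c + int a
                    - int ((2 * c) choose 2))
            * qbinom2 (int m - int c - int a - l) c"

definition odd_coeff :: "int \<Rightarrow> nat \<Rightarrow> nat \<Rightarrow> nat \<Rightarrow> Qq" where
  "odd_coeff l m c a =
     qq powi (2 * (int a + int c) * (int m - int a - l) - 2 * int a * int c + 2 * int a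
                    - int ((2 * c) choose 2))
            * qbinom2 (int m - int c - int a - l + 1) c"

lemma int_choose_double: "int ((2 * c) choose 2) = int c * (2 * int c - 1)"
  by (cases c) (simp_all add: choose_two algebra_simps)

lemma even_coeff_eq: "even_coeff l m c a =
     qq powi (2 * (int a + int c) * (int m - int a - l) - 2 * int a * int c + int a
                    - int c * (2 * int c - 1))
            * qbinom2 (int m - int c - int a - l) c"
  by (simp only: even_coeff_def int_choose_double)

lemma odd_coeff_eq: "odd_coeff l m c a =
     qq powi (2 * (int a + int c) * (int m - int a - l) - 2 * int a * int c + 2 * int a
                    - int c * (2 * int c - 1))
            * qbinom2 (int m - int c - int a - l + 1) c"
  by (simp only: odd_coeff_def int_choose_double)

text \<open>
  The scalar cores of the two recursions. With \<open>c = 0\<close> no binomial other than \<open>1\<close> occurs. Otherwise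
  both sides, multiplied with the denominator of the absorption rules, are multiples
  of \<open>[N-1; c-1]\<close>, and the cofactors agree after expansion.
\<close>

lemma odd_binom_identity:
  "qdiff (d + a) * qbinom2 N c =
     qq powi d * qdiff a * qbinom2 N c
     + qq powi (- a) * qdiff (d - 2 * int c) * qbinom2 (N - 1) c
     + (if c = 0 then 0 else
        qq powi (- a) * qdiff (2 * N + d - 2 * int c) * qbinom2 (N - 1) (c - 1))"
proof (cases c)
  case 0
  then show ?thesis by (simp add: qdiff_def algebra_simps powi_mult)
next
  case (Suc k)
  have nz: "qdiff (2 * int c) \<noteq> 0" using Suc by (simp add: qdiff_nonzero)
  have 1: "qdiff (2 * int c) * qbinom2 N c = qdiff (2 * N) * qbinom2 (N - 1) k"
    using qbinom2_absorb[of k "N - 1"] Suc by simp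
  have 2: "qdiff (2 * int c) * qbinom2 (N - 1) c = qdiff (2 * N - 2 * int c) * qbinom2 (N - 1) k"
    using qbinom2_Suc_lower[of k "N - 1"] Suc by (simp add: algebra_simps)
  have id: "qdiff (d + a) * qdiff (2 * N) = qq powi d * (qdiff a * qdiff (2 * N))
     + qq powi (- a) * (qdiff (d - 2 * int c) * qdiff (2 * N - 2 * int c))
     + qq powi (- a) * (qdiff (2 * int c) * qdiff (2 * N + d - 2 * int c))"
    unfolding qdiff_mult by (simp add: algebra_simps powi_mult)
  have "qdiff (2 * int c) * (qdiff (d + a) * qbinom2 N c) =
     (qdiff (d + a) * qdiff (2 * N)) * qbinom2 (N - 1) k"
    by (subst mult.left_commute) (simp only: 1 mult.assoc)
  also have "\<dots> = qq powi d * qdiff a * (qdiff (2 * int c) * qbinom2 N c)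
     + qq powi (- a) * qdiff (d - 2 * int c) * (qdiff (2 * int c) * qbinom2 (N - 1) c)
     + qdiff (2 * int c) * (qq powi (- a) * qdiff (2 * N + d - 2 * int c) * qbinom2 (N - 1) k)"
    unfolding id 1 2 by (simp add: algebra_simps)
  finally have "qdiff (2 * int c) * (qdiff (d + a) * qbinom2 N c) = qdiff (2 * int c) *
    (qq powi d * qdiff a * qbinom2 N c
     + qq powi (- a) * qdiff (d - 2 * int c) * qbinom2 (N - 1) c
     + qq powi (- a) * qdiff (2 * N + d - 2 * int c) * qbinom2 (N - 1) k)"
    by (simp add: algebra_simps)
  then show ?thesis using nz Suc by simp
qed

lemma even_binom_identity:
  "qdiff (d + a) * qbinom2 (N - 1) c =
     qq powi (d - 2 * int c) * qdiff a * qbinom2 N c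
     + qq powi (- a - 2 * int c) * qdiff (d - 2 * int c) * qbinom2 (N - 1) c
     + (if c = 0 then 0 else
        (qq powi (1 - a - 2 * int c) * qdiff (2 * N + d - 2 * int c - 1)
          - qq powi (1 - 2 * N) * qdiff (d + a - 1)) * qbinom2 (N - 1) (c - 1))"
proof (cases c)
  case 0
  then show ?thesis by (simp add: qdiff_def algebra_simps powi_mult)
next
  case (Suc k)
  have nz: "qdiff (2 * int c) \<noteq> 0" using Suc by (simp add: qdiff_nonzero)
  have 1: "qdiff (2 * int c) * qbinom2 N c = qdiff (2 * N) * qbinom2 (N - 1) k"
    using qbinom2_absorb[of k "N - 1"] Suc by simp
  have 2: "qdiff (2 * int c) * qbinom2 (N - 1) c = qdiff (2 * N - 2 * int c) * qbinom2 (N - 1) k"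
    using qbinom2_Suc_lower[of k "N - 1"] Suc by (simp add: algebra_simps)
  have id: "qdiff (d + a) * qdiff (2 * N - 2 * int c) =
     qq powi (d - 2 * int c) * (qdiff a * qdiff (2 * N))
     + qq powi (- a - 2 * int c) * (qdiff (d - 2 * int c) * qdiff (2 * N - 2 * int c))
     + qq powi (1 - a - 2 * int c) * (qdiff (2 * int c) * qdiff (2 * N + d - 2 * int c - 1))
     - qq powi (1 - 2 * N) * (qdiff (2 * int c) * qdiff (d + a - 1))"
    unfolding qdiff_mult by (simp add: algebra_simps powi_mult)
  have "qdiff (2 * int c) * (qdiff (d + a) * qbinom2 (N - 1) c) =
     (qdiff (d + a) * qdiff (2 * N - 2 * int c)) * qbinom2 (N - 1) k"
    by (subst mult.left_commute) (simp only: 2 mult.assoc)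
  also have "\<dots> = qq powi (d - 2 * int c) * qdiff a * (qdiff (2 * int c) * qbinom2 N c)
     + qq powi (- a - 2 * int c) * qdiff (d - 2 * int c) * (qdiff (2 * int c) * qbinom2 (N - 1) c)
     + qdiff (2 * int c) * ((qq powi (1 - a - 2 * int c) * qdiff (2 * N + d - 2 * int c - 1)
          - qq powi (1 - 2 * N) * qdiff (d + a - 1)) * qbinom2 (N - 1) k)"
    unfolding id 1 2 by (simp add: algebra_simps)
  finally have "qdiff (2 * int c) * (qdiff (d + a) * qbinom2 (N - 1) c) = qdiff (2 * int c) *
    (qq powi (d - 2 * int c) * qdiff a * qbinom2 N c
     + qq powi (- a - 2 * int c) * qdiff (d - 2 * int c) * qbinom2 (N - 1) c
     + (qq powi (1 - a - 2 * int c) * qdiff (2 * N + d - 2 * int c - 1)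
          - qq powi (1 - 2 * N) * qdiff (d + a - 1)) * qbinom2 (N - 1) k)"
    by (simp add: algebra_simps)
  then show ?thesis using nz Suc by simp
qed

text \<open>
  The coefficients of \<open>t (\<Sum> f(c,a) E\<^sup>(\<^sup>a\<^sup>) F\<^sup>(\<^sup>n\<^sup>-\<^sup>2\<^sup>c\<^sup>-\<^sup>a\<^sup>) 1\<^sub>w)\<close>; see \<open>tt_EF_sum\<close>. Here \<open>b\<close> is the exponent
  of \<open>F\<close> after the multiplication. For \<open>a = 0\<close> the value \<open>f c (a - 1)\<close> is harmless as
  its factor \<open>[a]\<close> vanishes, and likewise \<open>f c a\<close> for \<open>b = 0\<close>, where \<open>(c, a)\<close> is out of range for \<open>n\<close>.
\<close>

definition next_coeff :: "int \<Rightarrow> nat \<Rightarrow> (nat \<Rightarrow> nat \<Rightarrow> Qq) \<Rightarrow> nat \<Rightarrow> nat \<Rightarrow> Qq" where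
  "next_coeff w n f c a = (let b = int n + 1 - 2 * int c - int a in
     qq powi (1 - w - 2 * int a + 2 * b) * qint (int a) * f c (a - 1)
     + qint b * f c a
     - (if c = 0 then 0 else qint (w - 2 * b + int a) * f (c - 1) (a + 1)))"

lemma next_coeff_qdiff:
  "next_coeff w n f c a = (let b = int n + 1 - 2 * int c - int a in
     (qq powi (1 - w - 2 * int a + 2 * b) * qdiff (int a) * f c (a - 1)
     + qdiff b * f c a
     - (if c = 0 then 0 else qdiff (w - 2 * b + int a) * f (c - 1) (a + 1))) / qdiff 1)"
  by (simp add: next_coeff_def Let_def qint_qdiff add_divide_distrib diff_divide_distrib)

text \<open>
  Up to quantum integers, every coefficient here is a power of \<open>q\<close> times \<open>q\<^sup>e\<close> times one of the three
  binomials, where \<open>q\<^sup>e\<close> is the power in the coefficient on the left. The facts \<open>1\<close>, \<open>2\<close>, \<open>3\<close> (and \<open>5\<close> below)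
  extract \<open>q\<^sup>e\<close>, which leaves the scalar cores above.
\<close>

lemma odd_coeff_recursion:
  "qint (2 * int m + 1) * odd_coeff l m c a
     = next_coeff (2 * l - 1) (2 * m) (even_coeff l m) c a"
proof -
  define d where "d = 2 * int m + 1 - int a"
  define N where "N = int m - int c - int a - l + 1"
  define e where "e = 2 * (int a + int c) * (int m - int a - l) - 2 * int a * int c + 2 * int a
                    - int c * (2 * int c - 1)"
  have L: "odd_coeff l m c a = qq powi e * qbinom2 N c"
    by (simp add: odd_coeff_eq e_def N_def)
  have 1: "qq powi (2 * d - 4 * int c + 2 - 2 * l - 2 * int a) * qdiff (int a)
       * even_coeff l m c (a - 1) = qq powi e * (qq powi d * qdiff (int a) * qbinom2 N c)"
  proof (cases a)
    case (Suc k)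
    then show ?thesis
      by (simp add: even_coeff_eq e_def N_def d_def algebra_simps powi_mult)
  qed simp
  have 2: "even_coeff l m c a = qq powi e * (qq powi (- int a) * qbinom2 (N - 1) c)"
    by (simp add: even_coeff_eq e_def N_def algebra_simps powi_mult)
  have 3: "even_coeff l m (c - 1) (a + 1)
      = qq powi e * (qq powi (- int a) * qbinom2 (N - 1) (c - 1))" if "c \<noteq> 0"
    using that by (cases c) (simp_all add: even_coeff_eq e_def N_def algebra_simps powi_mult)
  have 4: "qdiff (2 * l - 1 - 2 * (d - 2 * int c) + int a) = - qdiff (2 * N + d - 2 * int c)"
    by (simp add: d_def N_def algebra_simps flip: qdiff_minus)
  have "qdiff (2 * int m + 1) * odd_coeff l m c a = qq powi e * (qdiff (d + int a) * qbinom2 N c)"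
    by (simp add: L d_def)
  also have "\<dots> = qq powi (2 * d - 4 * int c + 2 - 2 * l - 2 * int a) * qdiff (int a)
       * even_coeff l m c (a - 1)
     + qdiff (d - 2 * int c) * even_coeff l m c a
     - (if c = 0 then 0 else
        qdiff (2 * l - 1 - 2 * (d - 2 * int c) + int a) * even_coeff l m (c - 1) (a + 1))"
    unfolding odd_binom_identity 1 2 4 using 3 by (simp add: algebra_simps)
  finally have *: "qdiff (2 * int m + 1) * odd_coeff l m c a = \<dots>" .
  have b: "int (2 * m) + 1 - 2 * int c - int a = d - 2 * int c"
    by (simp add: d_def)
  have e': "1 - (2 * l - 1) - 2 * int a + 2 * (d - 2 * int c)
      = 2 * d - 4 * int c + 2 - 2 * l - 2 * int a"
    by simp
  show ?thesis
    unfolding next_coeff_qdiff Let_def b e' qint_qdiff times_divide_eq_left * ..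
qed

lemma even_coeff_recursion:
  "qint (2 * int m + 2) * even_coeff l (Suc m) c a
     = next_coeff (2 * l - 1) (2 * m + 1) (odd_coeff l m) c a
       - (if c = 0 then 0 else qint (2 * int m + 1) * even_coeff l m (c - 1) a)"
proof -
  define d where "d = 2 * int m + 2 - int a"
  define N where "N = int m - int c - int a - l + 2"
  define e where "e = 2 * (int a + int c) * (int m + 1 - int a - l) - 2 * int a * int c + int a
                    - int c * (2 * int c - 1)"
  have L: "even_coeff l (Suc m) c a = qq powi e * qbinom2 (N - 1) c"
    by (simp add: even_coeff_eq e_def N_def algebra_simps)
  have 1: "qq powi (2 * d - 4 * int c + 2 - 2 * l - 2 * int a) * qdiff (int a)
       * odd_coeff l m c (a - 1) = qq powi e * (qq powi (d - 2 * int c) * qdiff (int a) * qbinom2 N c)"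
  proof (cases a)
    case (Suc k)
    then show ?thesis
      by (simp add: odd_coeff_eq e_def N_def d_def algebra_simps powi_mult)
  qed simp
  have 2: "odd_coeff l m c a = qq powi e * (qq powi (- int a - 2 * int c) * qbinom2 (N - 1) c)"
    by (simp add: odd_coeff_eq e_def N_def algebra_simps powi_mult)
  have 3: "odd_coeff l m (c - 1) (a + 1)
      = qq powi e * (qq powi (1 - int a - 2 * int c) * qbinom2 (N - 1) (c - 1))" if "c \<noteq> 0"
    using that by (cases c) (simp_all add: odd_coeff_eq e_def N_def algebra_simps powi_mult)
  have 5: "even_coeff l m (c - 1) a
      = qq powi e * (qq powi (1 - 2 * N) * qbinom2 (N - 1) (c - 1))" if "c \<noteq> 0"
    using that by (cases c) (simp_all add: even_coeff_eq e_def N_def algebra_simps powi_mult)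
  have 4: "qdiff (2 * l - 1 - 2 * (d - 2 * int c) + int a) = - qdiff (2 * N + d - 2 * int c - 1)"
    by (simp add: d_def N_def algebra_simps flip: qdiff_minus)
  have "qdiff (2 * int m + 2) * even_coeff l (Suc m) c a
      = qq powi e * (qdiff (d + int a) * qbinom2 (N - 1) c)"
    by (simp add: L d_def)
  also have "\<dots> = qq powi (2 * d - 4 * int c + 2 - 2 * l - 2 * int a) * qdiff (int a)
       * odd_coeff l m c (a - 1)
     + qdiff (d - 2 * int c) * odd_coeff l m c a
     - (if c = 0 then 0 else
        qdiff (2 * l - 1 - 2 * (d - 2 * int c) + int a) * odd_coeff l m (c - 1) (a + 1))
     - (if c = 0 then 0 else qdiff (d + int a - 1) * even_coeff l m (c - 1) a)"
    unfolding even_binom_identity 1 2 4 using 3 5 by (simp add: algebra_simps)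
  finally have *: "qdiff (2 * int m + 2) * even_coeff l (Suc m) c a = \<dots>" .
  have b: "int (2 * m + 1) + 1 - 2 * int c - int a = d - 2 * int c"
    by (simp add: d_def)
  have e': "1 - (2 * l - 1) - 2 * int a + 2 * (d - 2 * int c)
      = 2 * d - 4 * int c + 2 - 2 * l - 2 * int a"
    by simp
  have d': "2 * int m + 1 = d + int a - 1"
    by (simp add: d_def)
  show ?thesis
    unfolding next_coeff_qdiff Let_def b e' qint_qdiff times_divide_eq_left * d'
    by (simp add: diff_divide_distrib)
qed

section \<open>Recursions for the i-divided powers\<close>

lemma scaleQ_sum_right: "c *\<^sub>q (\<Sum>i\<in>A. f i) = (\<Sum>i\<in>A. c *\<^sub>q (f i :: 'a :: Qq_algebra))"
  by (induction A rule: infinite_finite_induct) (simp_all add: scaleQ_add_right)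

lemma act_zero_right [simp]: "x \<rhd> 0 = 0"
  using act_module(5)[of x 0 0] by simp

lemma act_sum: "x \<rhd> (\<Sum>i\<in>A. f i) = (\<Sum>i\<in>A. x \<rhd> f i)"
  by (induction A rule: infinite_finite_induct) (simp_all add: act_module(5))

lemma act_minus_left: "(- x) \<rhd> v = - (x \<rhd> v)"
proof -
  have "0 \<rhd> v = 0" using act_module(3)[of 0 0 v] by simp
  then show ?thesis using act_module(3)[of "- x" x v] by (simp add: eq_neg_iff_add_eq_0)
qed

lemma act_diff_left: "(x - y) \<rhd> v = x \<rhd> v - y \<rhd> v"
  using act_module(3)[of x "- y" v] by (simp add: act_minus_left)

lemma act_minus_right: "x \<rhd> (- v) = - (x \<rhd> v)"
  using act_module(5)[of x "- v" v] by (simp add: eq_neg_iff_add_eq_0)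

lemma act_diff_right: "x \<rhd> (v - w) = x \<rhd> v - x \<rhd> w"
  using act_module(5)[of x v "- w"] by (simp add: act_minus_right)

lemma tt_commute_prod: "tt * prod_list (map (\<lambda>i. tt - f i *\<^sub>q 1) xs)
    = prod_list (map (\<lambda>i. tt - f i *\<^sub>q 1) xs) * tt"
proof (induction xs)
  case (Cons x xs)
  let ?P = "prod_list (map (\<lambda>i. tt - f i *\<^sub>q 1) xs)"
  have "tt * ((tt - f x *\<^sub>q 1) * ?P) = (tt - f x *\<^sub>q 1) * (tt * ?P)"
    by (simp add: algebra_simps scaleQ_mult_left scaleQ_mult_right)
  then show ?case using Cons by (simp add: mult.assoc)
qed simp

text \<open>
  Passing from \<open>a\<close> to \<open>a + 1\<close> adds the factors \<open>t - [-2a-1]\<close> on the left and \<open>t - [2a+1]\<close> on the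
  right. Since \<open>[-k] = -[k]\<close> and everything commutes with \<open>t\<close>, they combine to \<open>t\<^sup>2 - [2a+1]\<^sup>2\<close>.
\<close>

lemma tt_prod_Suc:
  "tt_prod (Suc a) = tt * (tt * tt_prod a) - (qint (2 * int a + 1))\<^sup>2 *\<^sub>q tt_prod a"
proof -
  let ?k = "qint (2 * int a + 1)"
  have c: "tt_prod a * tt = tt * tt_prod a"
    unfolding tt_prod_def using tt_commute_prod[of "\<lambda>i. qint (2 * i - 1)"] by simp
  have 1: "[1 - int (Suc a) .. int (Suc a)] = - int a # [1 - int a .. int a] @ [int a + 1]"
    using upto_rec1[of "- int a" "int a + 1"] upto_rec2[of "1 - int a" "int a + 1"]
    by (simp add: add.commute[of 1])
  have "qint (- (2 * int a) - 1) = - ?k"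
    by (simp flip: qint_minus)
  then have "tt_prod (Suc a) = (tt - (- ?k) *\<^sub>q 1) * (tt_prod a * (tt - ?k *\<^sub>q 1))"
    unfolding tt_prod_def 1 by (simp add: mult.assoc algebra_simps)
  also have "\<dots> = tt * (tt * tt_prod a) - ?k\<^sup>2 *\<^sub>q tt_prod a"
    using scaleQ_diff_left[of 0 ?k "1 :: U"]
    by (simp add: algebra_simps c scaleQ_mult_left scaleQ_mult_right scaleQ_scaleQ power2_eq_square
        scaleQ_add_right mult.assoc scaleQ_minus_right)
  finally show ?thesis .
qed

lemma tt_idiv_odd_even: "tt * idiv_odd (2 * m) = qint (2 * int m + 1) *\<^sub>q idiv_odd (2 * m + 1)"
  using qfact_Suc[of "2 * m"] qint_nonzero[of "2 * int m + 1"]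
  by (simp add: idiv_odd_def scaleQ_scaleQ scaleQ_mult_right add.commute)

lemma tt_idiv_odd_odd: "tt * idiv_odd (2 * m + 1)
   = qint (2 * int m + 2) *\<^sub>q idiv_odd (2 * Suc m) + qint (2 * int m + 1) *\<^sub>q idiv_odd (2 * m)"
proof -
  have nz: "qint (2 * int m + 1) \<noteq> 0" "qint (2 * int m + 2) \<noteq> 0"
    by (simp_all add: qint_nonzero)
  have f1: "qfact (2 * m + 1) = qint (2 * int m + 1) * qfact (2 * m)"
    using qfact_Suc[of "2 * m"] by (simp add: add.commute)
  have f2: "qfact (2 * Suc m) = qint (2 * int m + 2) * qfact (2 * m + 1)"
    using qfact_Suc[of "2 * m + 1"] by (simp add: add.commute)
  have "tt * (tt * tt_prod m) = tt_prod (Suc m) + (qint (2 * int m + 1))\<^sup>2 *\<^sub>q tt_prod m"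
    by (simp add: tt_prod_Suc)
  then show ?thesis
    unfolding idiv_odd_even idiv_odd_odd f2 f1 using nz
    by (simp add: scaleQ_mult_right scaleQ_scaleQ scaleQ_add_right power2_eq_square)
qed

section \<open>The action on weight vectors\<close>

definition has_weight :: "int \<Rightarrow> dU \<Rightarrow> bool" where
  "has_weight w v \<longleftrightarrow> K \<rhd> v = qq powi w *\<^sub>q v"

lemma has_weight_idem: "has_weight w (idem w)"
  by (simp add: has_weight_def act_idem)

lemma Kinv_act_weight:
  assumes "has_weight w v"
  shows "Kinv \<rhd> v = qq powi (- w) *\<^sub>q v"
proof -
  have "v = Kinv \<rhd> K \<rhd> v"
    by (simp add: U_relations(2) act_module(1) flip: act_module(2))
  also have "\<dots> = qq powi w *\<^sub>q (Kinv \<rhd> v)"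
    using assms by (simp add: has_weight_def act_module(6))
  finally have "qq powi (- w) *\<^sub>q v = qq powi (- w) *\<^sub>q qq powi w *\<^sub>q (Kinv \<rhd> v)"
    by simp
  then show ?thesis by (simp add: scaleQ_scaleQ scaleQ_one power_int_minus)
qed

lemma has_weight_E: assumes "has_weight w v" shows "has_weight (w + 2) (E \<rhd> v)"
proof -
  have "K \<rhd> E \<rhd> v = qq powi 2 *\<^sub>q (E \<rhd> K \<rhd> v)"
    using arg_cong[OF U_relations(4), of "\<lambda>x. x \<rhd> v"] by (simp only: act_module)
  then show ?thesis
    using assms by (simp add: has_weight_def act_module(6) scaleQ_scaleQ power_int_add mult.commute)
qed

lemma has_weight_F: assumes "has_weight w v" shows "has_weight (w - 2) (F \<rhd> v)"
proof -
  have "K \<rhd> F \<rhd> v = qq powi (- 2) *\<^sub>q (F \<rhd> K \<rhd> v)"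
    using arg_cong[OF U_relations(5), of "\<lambda>x. x \<rhd> v"] by (simp only: act_module)
  then show ?thesis
    using assms by (simp add: has_weight_def act_module(6) scaleQ_scaleQ power_int_diff
        power_int_minus field_simps)
qed

lemma has_weight_scaleQ: "has_weight w v \<Longrightarrow> has_weight w (c *\<^sub>q v)"
  by (simp add: has_weight_def act_module(6) scaleQ_scaleQ mult.commute)

lemma has_weight_divE:
  assumes "has_weight w v" shows "has_weight (w + 2 * int n) (divE n \<rhd> v)"
proof -
  have "has_weight (w + 2 * int n) (E ^ n \<rhd> v)"
  proof (induction n)
    case (Suc n)
    then show ?case using has_weight_E by (fastforce simp: act_module algebra_simps)
  qed (use assms in \<open>simp add: act_module\<close>)
  then show ?thesis by (simp add: divE_def act_module has_weight_scaleQ)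
qed

lemma has_weight_divF:
  assumes "has_weight w v" shows "has_weight (w - 2 * int n) (divF n \<rhd> v)"
proof -
  have "has_weight (w - 2 * int n) (F ^ n \<rhd> v)"
  proof (induction n)
    case (Suc n)
    then show ?case using has_weight_F by (fastforce simp: act_module algebra_simps)
  qed (use assms in \<open>simp add: act_module\<close>)
  then show ?thesis by (simp add: divF_def act_module has_weight_scaleQ)
qed

lemma FE_act_weight:
  assumes "has_weight w v"
  shows "F \<rhd> E \<rhd> v = E \<rhd> F \<rhd> v - qint w *\<^sub>q v"
proof -
  have "E \<rhd> F \<rhd> v - F \<rhd> E \<rhd> v = (1 / (qq - inverse qq)) *\<^sub>q (K \<rhd> v - Kinv \<rhd> v)"
    using arg_cong[OF U_relations(3), of "\<lambda>x. x \<rhd> v"] by (simp only: act_module act_diff_left)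
  also have "\<dots> = qint w *\<^sub>q v"
    using assms Kinv_act_weight[OF assms]
    by (simp add: has_weight_def qint_def scaleQ_scaleQ flip: scaleQ_diff_left)
  finally show ?thesis by (simp add: algebra_simps)
qed

lemma qint_sum_identity: "qint w + qint n * qint (w + n + 1) = qint (n + 1) * qint (w + n)"
proof -
  have nz: "qdiff 1 \<noteq> 0" by (simp add: qdiff_nonzero)
  have "qdiff w * qdiff 1 + qdiff n * qdiff (w + n + 1) = qdiff (n + 1) * qdiff (w + n)"
    unfolding qdiff_mult by (simp add: algebra_simps minus_diff_commute)
  then show ?thesis using nz by (simp add: qint_qdiff field_simps)
qed

text \<open>
  The classical commutation of \<open>F\<close> with powers of \<open>E\<close>. For \<open>n = 0\<close> the truncated exponent in
  \<open>E ^ (n - 1)\<close> is harmless because of the factor \<open>[n] = 0\<close>.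
\<close>

lemma F_E_power_act:
  assumes "has_weight w v"
  shows "F \<rhd> E ^ n \<rhd> v = E ^ n \<rhd> F \<rhd> v - (qint (int n) * qint (w + int n - 1)) *\<^sub>q (E ^ (n - 1) \<rhd> v)"
  using assms
proof (induction n arbitrary: w v)
  case (Suc n)
  have p: "E ^ Suc n \<rhd> x = E ^ n \<rhd> E \<rhd> x" for x n
    by (simp only: power_Suc2 act_module)
  have q: "qint (int n) *\<^sub>q (E ^ (n - 1) \<rhd> E \<rhd> v) = qint (int n) *\<^sub>q (E ^ n \<rhd> v)"
    by (cases n) (simp_all only: qint_0 of_nat_0 scaleQ_zero_left diff_Suc_1 p)
  have "F \<rhd> E ^ Suc n \<rhd> v = E ^ n \<rhd> F \<rhd> E \<rhd> v
      - (qint (int n) * qint (w + 2 + int n - 1)) *\<^sub>q (E ^ (n - 1) \<rhd> E \<rhd> v)"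
    unfolding p using Suc.IH[OF has_weight_E[OF Suc.prems]] by simp
  also have "(qint (int n) * qint (w + 2 + int n - 1)) *\<^sub>q (E ^ (n - 1) \<rhd> E \<rhd> v)
     = (qint (int n) * qint (w + int n + 1)) *\<^sub>q (E ^ n \<rhd> v)"
    using arg_cong[OF q, of "\<lambda>x. qint (w + int n + 1) *\<^sub>q x"]
    by (simp add: scaleQ_scaleQ algebra_simps)
  also have "E ^ n \<rhd> F \<rhd> E \<rhd> v = E ^ Suc n \<rhd> F \<rhd> v - qint w *\<^sub>q (E ^ n \<rhd> v)"
    by (simp only: FE_act_weight[OF Suc.prems] act_diff_right act_module(6) p)
  finally have "F \<rhd> E ^ Suc n \<rhd> v = E ^ Suc n \<rhd> F \<rhd> v
     - (qint w + qint (int n) * qint (w + int n + 1)) *\<^sub>q (E ^ n \<rhd> v)"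
    by (simp add: scaleQ_add_left algebra_simps)
  then show ?case unfolding qint_sum_identity by (simp add: add.commute)
qed (simp add: act_module)

lemma F_divE_act:
  assumes "has_weight w v"
  shows "F \<rhd> divE (Suc n) \<rhd> v = divE (Suc n) \<rhd> F \<rhd> v - qint (w + int n) *\<^sub>q (divE n \<rhd> v)"
proof -
  have nz: "qint (1 + int n) \<noteq> 0" by (simp add: qint_nonzero)
  have "F \<rhd> divE (Suc n) \<rhd> v = (1 / qfact (Suc n)) *\<^sub>q (F \<rhd> E ^ Suc n \<rhd> v)"
    by (simp only: divE_def act_module)
  also have "\<dots> = (1 / qfact (Suc n)) *\<^sub>q (E ^ Suc n \<rhd> F \<rhd> v)
     - (1 / qfact (Suc n)) *\<^sub>q (qint (1 + int n) * qint (w + int n)) *\<^sub>q (E ^ n \<rhd> v)"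
    using scaleQ_add_right[of "1 / qfact (Suc n)" _ "- x" for x]
    by (subst F_E_power_act[OF assms]) (simp add: scaleQ_minus_right del: power_Suc)
  also have "\<dots> = divE (Suc n) \<rhd> F \<rhd> v - qint (w + int n) *\<^sub>q (divE n \<rhd> v)"
    using nz by (simp add: divE_def act_module scaleQ_scaleQ qfact_Suc del: power_Suc)
  finally show ?thesis .
qed

lemma E_divE_act: "E \<rhd> divE n \<rhd> v = qint (int n + 1) *\<^sub>q (divE (Suc n) \<rhd> v)"
  using qint_nonzero[of "1 + int n"]
  by (simp add: divE_def act_module scaleQ_scaleQ qfact_Suc add.commute)

lemma F_divF_act: "F \<rhd> divF n \<rhd> v = qint (int n + 1) *\<^sub>q (divF (Suc n) \<rhd> v)"
  using qint_nonzero[of "1 + int n"]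
  by (simp add: divF_def act_module scaleQ_scaleQ qfact_Suc add.commute)

definition EF_vec :: "int \<Rightarrow> nat \<Rightarrow> nat \<Rightarrow> dU" where
  "EF_vec w a b = (divE a * divF b) \<rhd> idem w"

text \<open>
  The first term comes from \<open>q\<^sup>-\<^sup>1 E K\<^sup>-\<^sup>1\<close>, where \<open>K\<^sup>-\<^sup>1\<close> contributes the weight \<open>w + 2a - 2b\<close>; the other
  two come from \<open>F\<close>, which moves past \<open>E\<^sup>(\<^sup>a\<^sup>)\<close> at the price of a multiple of \<open>E\<^sup>(\<^sup>a\<^sup>-\<^sup>1\<^sup>)\<close>.
\<close>

lemma tt_EF_vec:
  "tt \<rhd> EF_vec w a b =
     (qq powi (- 1 - w - 2 * int a + 2 * int b) * qint (int a + 1)) *\<^sub>q EF_vec w (Suc a) b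
     + qint (int b + 1) *\<^sub>q EF_vec w a (Suc b)
     - (if a = 0 then 0 else qint (w - 2 * int b + int a - 1) *\<^sub>q EF_vec w (a - 1) b)"
proof -
  let ?y = "divF b \<rhd> idem w"
  have wy: "has_weight (w - 2 * int b) ?y"
    by (intro has_weight_divF has_weight_idem)
  have q_powers: "inverse qq * (qq powi (- (w - 2 * int b + 2 * int a)) * x)
      = qq powi (- 1 - w - 2 * int a + 2 * int b) * x" for x
    unfolding inverse_qq powi_mult by (simp add: algebra_simps minus_diff_commute)
  have "Kinv \<rhd> divE a \<rhd> ?y = qq powi (- (w - 2 * int b + 2 * int a)) *\<^sub>q (divE a \<rhd> ?y)"
    by (intro Kinv_act_weight has_weight_divE wy)
  then have 1: "Echeck \<rhd> divE a \<rhd> ?y =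
      (qq powi (- 1 - w - 2 * int a + 2 * int b) * qint (int a + 1)) *\<^sub>q (divE (Suc a) \<rhd> ?y)"
    by (simp only: Echeck_def act_module E_divE_act scaleQ_scaleQ q_powers)
  have 2: "F \<rhd> divE a \<rhd> ?y = divE a \<rhd> F \<rhd> ?y
     - (if a = 0 then 0 else qint (w - 2 * int b + int a - 1) *\<^sub>q (divE (a - 1) \<rhd> ?y))"
  proof (cases a)
    case 0
    then show ?thesis by (simp add: divE_def act_module scaleQ_one)
  next
    case (Suc k)
    then show ?thesis using F_divE_act[OF wy, of k] by (simp add: algebra_simps)
  qed
  show ?thesis
    by (simp add: tt_def EF_vec_def act_module 1 2 F_divF_act)
qed

section \<open>Sums over the PBW-type elements\<close>

text \<open>
  The exponents \<open>(a, b)\<close> in the expansion of degree \<open>n\<close> are those with \<open>a + b + 2c = n\<close>; the pairs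
  \<open>(c, a)\<close> below parametrise them for both parities of \<open>n\<close>.
\<close>

definition tri :: "nat \<Rightarrow> (nat \<times> nat) set" where
  "tri n = {(c, a). 2 * c + a \<le> n}"

lemma mem_tri [simp]: "(c, a) \<in> tri n \<longleftrightarrow> 2 * c + a \<le> n"
  by (simp add: tri_def)

lemma finite_tri [simp]: "finite (tri n)"
  by (rule finite_subset[of _ "{..n} \<times> {..n}"]) (auto simp: tri_def)

lemma sum_tri: "(\<Sum>(c, a)\<in>tri n. f c a) = (\<Sum>c = 0..n div 2. \<Sum>a = 0..n - 2 * c. f c a)"
proof -
  have "tri n = (SIGMA c:{0..n div 2}. {0..n - 2 * c})"
    by (auto simp: tri_def)
  then show ?thesis by (simp add: sum.Sigma)
qed

definition EF_sum :: "int \<Rightarrow> nat \<Rightarrow> (nat \<Rightarrow> nat \<Rightarrow> Qq) \<Rightarrow> dU" where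
  "EF_sum w n f = (\<Sum>(c, a)\<in>tri n. f c a *\<^sub>q EF_vec w a (n - 2 * c - a))"

lemma EF_sum_scaleQ: "r *\<^sub>q EF_sum w n f = EF_sum w n (\<lambda>c a. r * f c a)"
  by (simp add: EF_sum_def scaleQ_sum_right scaleQ_scaleQ case_prod_unfold)

lemma EF_sum_diff: "EF_sum w n f - EF_sum w n g = EF_sum w n (\<lambda>c a. f c a - g c a)"
  by (simp add: EF_sum_def scaleQ_diff_left case_prod_unfold sum_subtractf)

lemma EF_sum_add: "EF_sum w n f + EF_sum w n g = EF_sum w n (\<lambda>c a. f c a + g c a)"
  by (simp add: EF_sum_def scaleQ_add_left case_prod_unfold sum.distrib)

text \<open>
  Lowering the degree by two is a shift in \<open>c\<close>, as \<open>n - 2c = (n + 2) - 2(c + 1)\<close>. It makes the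
  term \<open>[2m+1] t\<^sup>(\<^sup>2\<^sup>m\<^sup>)\<close> of the second recursion comparable with the other ones.
\<close>

lemma EF_sum_shift:
  "EF_sum w n f = EF_sum w (n + 2) (\<lambda>c a. if c = 0 then 0 else f (c - 1) a)"
  unfolding EF_sum_def
  by (rule sum.reindex_bij_witness_not_neutral[where S' = "{}" and T' = "{(c, a). c = 0} \<inter> tri (n + 2)"
        and i = "\<lambda>(c, a). (c - 1, a)" and j = "\<lambda>(c, a). (c + 1, a)"])
    auto

text \<open>
  The three terms of \<open>tt_EF_vec\<close> are reindexed by \<open>(c, a) \<mapsto> (c, a + 1)\<close>, the identity and
  \<open>(c, a) \<mapsto> (c + 1, a - 1)\<close>. The index pairs that are not hit have coefficient zero.
\<close>

lemma tt_EF_sum: "tt \<rhd> EF_sum w n f = EF_sum w (n + 1) (next_coeff w n f)"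
proof -
  let ?b = "\<lambda>c a. int n - 2 * int c - int a"
  have "tt \<rhd> EF_sum w n f =
     (\<Sum>(c, a)\<in>tri n. (f c a * (qq powi (- 1 - w - 2 * int a + 2 * ?b c a) * qint (int a + 1)))
          *\<^sub>q EF_vec w (Suc a) (n - 2 * c - a))
     + (\<Sum>(c, a)\<in>tri n. (f c a * qint (?b c a + 1)) *\<^sub>q EF_vec w a (Suc (n - 2 * c - a)))
     - (\<Sum>(c, a)\<in>tri n. if a = 0 then 0 else
          (f c a * qint (w - 2 * ?b c a + int a - 1)) *\<^sub>q EF_vec w (a - 1) (n - 2 * c - a))"
    unfolding EF_sum_def act_sum sum.distrib[symmetric] sum_subtractf[symmetric]
  proof (rule sum.cong, goal_cases)
    case (2 x)
    obtain c a where x: "x = (c, a)" by force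
    with 2 have b: "2 * c + a \<le> n" by auto
    have *: "r *\<^sub>q (u - v) = r *\<^sub>q u - r *\<^sub>q v" for r and u v :: dU
      using scaleQ_add_right[of r u "- v"] by (simp add: scaleQ_minus_right)
    show ?case
      by (simp add: x act_module(6) tt_EF_vec b of_nat_diff diff_diff_eq * scaleQ_add_right scaleQ_scaleQ)
  qed simp
  also have "(\<Sum>(c, a)\<in>tri n. (f c a * (qq powi (- 1 - w - 2 * int a + 2 * ?b c a) * qint (int a + 1)))
          *\<^sub>q EF_vec w (Suc a) (n - 2 * c - a))
     = EF_sum w (n + 1) (\<lambda>c a. qq powi (1 - w - 2 * int a + 2 * (int n + 1 - 2 * int c - int a))
          * qint (int a) * f c (a - 1))"
    unfolding EF_sum_def
    by (rule sum.reindex_bij_witness_not_neutral[where S' = "{}" and T' = "{(c, a). a = 0} \<inter> tri (n + 1)"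
        and i = "\<lambda>(c, a). (c, a - 1)" and j = "\<lambda>(c, a). (c, a + 1)"])
      (auto simp: algebra_simps)
  also have "(\<Sum>(c, a)\<in>tri n. (f c a * qint (?b c a + 1)) *\<^sub>q EF_vec w a (Suc (n - 2 * c - a)))
     = EF_sum w (n + 1) (\<lambda>c a. qint (int n + 1 - 2 * int c - int a) * f c a)"
    unfolding EF_sum_def
  proof (rule sum.mono_neutral_cong_left)
    show "\<forall>i\<in>tri (n + 1) - tri n. (case i of (c, a) \<Rightarrow>
       (qint (int n + 1 - 2 * int c - int a) * f c a) *\<^sub>q EF_vec w a (n + 1 - 2 * c - a)) = 0"
    proof
      fix i assume i: "i \<in> tri (n + 1) - tri n"
      obtain c a where x: "i = (c, a)" by force
      with i have "int n + 1 - 2 * int c - int a = 0" by auto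
      then show "(case i of (c, a) \<Rightarrow>
       (qint (int n + 1 - 2 * int c - int a) * f c a) *\<^sub>q EF_vec w a (n + 1 - 2 * c - a)) = 0"
        by (simp add: x)
    qed
  qed (auto simp: algebra_simps Suc_diff_le)
  also have "(\<Sum>(c, a)\<in>tri n. if a = 0 then 0 else
          (f c a * qint (w - 2 * ?b c a + int a - 1)) *\<^sub>q EF_vec w (a - 1) (n - 2 * c - a))
     = EF_sum w (n + 1) (\<lambda>c a. if c = 0 then 0 else
          qint (w - 2 * (int n + 1 - 2 * int c - int a) + int a) * f (c - 1) (a + 1))"
    unfolding EF_sum_def
    \<comment> \<open>the vanishing terms with \<open>a = 0\<close> must go to an index whose term vanishes too, such as \<open>(0, 0)\<close>\<close>
    by (rule sum.reindex_bij_witness_not_neutral[where S' = "{(c, a). a = 0} \<inter> tri n"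
        and T' = "{(c, a). c = 0} \<inter> tri (n + 1)"
        and i = "\<lambda>(c, a). (c - 1, a + 1)"
        and j = "\<lambda>(c, a). if a = 0 then (0, 0) else (c + 1, a - 1)"])
      (auto simp: algebra_simps)
  finally show ?thesis
    unfolding EF_sum_add EF_sum_diff next_coeff_def Let_def .
qed

section \<open>The expansions\<close>

lemma scaleQ_cancel:
  assumes "c \<noteq> 0" "c *\<^sub>q x = c *\<^sub>q (y :: 'a :: Qq_algebra)"
  shows "x = y"
  using arg_cong[OF assms(2), of "\<lambda>z. inverse c *\<^sub>q z"] assms(1) by (simp add: scaleQ_scaleQ scaleQ_one)

lemma idiv_odd_even_imp_odd:
  assumes "idiv_odd (2 * m) \<rhd> idem (2 * l - 1) = EF_sum (2 * l - 1) (2 * m) (even_coeff l m)"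
  shows "idiv_odd (2 * m + 1) \<rhd> idem (2 * l - 1) = EF_sum (2 * l - 1) (2 * m + 1) (odd_coeff l m)"
proof (rule scaleQ_cancel)
  show "qint (2 * int m + 1) \<noteq> 0" by (simp add: qint_nonzero)
  have "qint (2 * int m + 1) *\<^sub>q (idiv_odd (2 * m + 1) \<rhd> idem (2 * l - 1))
     = tt \<rhd> idiv_odd (2 * m) \<rhd> idem (2 * l - 1)"
    by (simp only: tt_idiv_odd_even flip: act_module)
  also have "\<dots> = qint (2 * int m + 1) *\<^sub>q EF_sum (2 * l - 1) (2 * m + 1) (odd_coeff l m)"
    unfolding assms tt_EF_sum EF_sum_scaleQ odd_coeff_recursion ..
  finally show "qint (2 * int m + 1) *\<^sub>q (idiv_odd (2 * m + 1) \<rhd> idem (2 * l - 1))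
     = qint (2 * int m + 1) *\<^sub>q EF_sum (2 * l - 1) (2 * m + 1) (odd_coeff l m)" .
qed

lemma idiv_odd_even_expansion:
  "idiv_odd (2 * m) \<rhd> idem (2 * l - 1) = EF_sum (2 * l - 1) (2 * m) (even_coeff l m)"
proof (induction m)
  case 0
  have "tri 0 = {(0, 0)}" by (auto simp: tri_def)
  then show ?case
    by (simp add: idiv_odd_def tt_prod_def EF_sum_def EF_vec_def even_coeff_eq divE_def divF_def
        scaleQ_one act_module)
next
  case (Suc m)
  show ?case
  proof (rule scaleQ_cancel)
    show "qint (2 * int m + 2) \<noteq> 0" by (simp add: qint_nonzero)
    have "qint (2 * int m + 2) *\<^sub>q (idiv_odd (2 * Suc m) \<rhd> idem (2 * l - 1))
       = tt \<rhd> idiv_odd (2 * m + 1) \<rhd> idem (2 * l - 1)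
         - qint (2 * int m + 1) *\<^sub>q (idiv_odd (2 * m) \<rhd> idem (2 * l - 1))"
      by (simp only: tt_idiv_odd_odd act_module(3,4) add_diff_cancel_right' flip: act_module(2))
    also have "\<dots> = qint (2 * int m + 2) *\<^sub>q EF_sum (2 * l - 1) (2 * Suc m) (even_coeff l (Suc m))"
      unfolding idiv_odd_even_imp_odd[OF Suc.IH] unfolding Suc.IH tt_EF_sum EF_sum_scaleQ
      unfolding EF_sum_shift[of _ "2 * m"] even_coeff_recursion
      by (simp add: EF_sum_diff)
    finally show "qint (2 * int m + 2) *\<^sub>q (idiv_odd (2 * Suc m) \<rhd> idem (2 * l - 1))
      = qint (2 * int m + 2) *\<^sub>q EF_sum (2 * l - 1) (2 * Suc m) (even_coeff l (Suc m))" .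
  qed
qed

lemmas idiv_odd_odd_expansion = idiv_odd_even_imp_odd[OF idiv_odd_even_expansion]

section \<open>Membership in the integral form\<close>

lemma divF_target: "idem (w - 2 * int b) * (divF b \<rhd> idem w) = divF b \<rhd> idem w"
proof -
  have "idem (w - 2 * int b) * (F ^ b \<rhd> idem w) = F ^ b \<rhd> idem w"
  proof (induction b)
    case (Suc b)
    let ?x = "F ^ b \<rhd> idem w" and ?n = "w - 2 * int b"
    have "F ^ Suc b \<rhd> idem w = F \<rhd> (idem ?n * ?x)"
      by (simp add: Suc act_module(2))
    also have "\<dots> = dgen (DF ?n) * ?x"
      by (simp add: act_module(7) act_idem)
    finally have *: "F ^ Suc b \<rhd> idem w = dgen (DF ?n) * ?x" .
    have "idem (?n - 2) * (dgen (DF ?n) * ?x) = dgen (DF ?n) * ?x"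
      by (simp add: dU_relations flip: mult.assoc)
    then show ?case unfolding * by (simp add: algebra_simps)
  qed (simp add: act_module dU_relations)
  then show ?thesis by (simp add: divF_def act_module scaleQ_mult_right)
qed

text \<open>
  Inserting the idempotent \<open>1\<^sub>w\<^sub>-\<^sub>2\<^sub>b\<close> between \<open>E\<^sup>(\<^sup>a\<^sup>)\<close> and \<open>F\<^sup>(\<^sup>b\<^sup>) 1\<^sub>w\<close> exhibits a product of two generators
  of the integral form.
\<close>

lemma EF_vec_AdU: "EF_vec w a b \<in> AdU"
proof -
  have "EF_vec w a b = (divE a \<rhd> idem (w - 2 * int b)) * (divF b \<rhd> idem w)"
    by (simp only: EF_vec_def act_module(2) divF_target flip: act_module(7))
  then show ?thesis by (simp add: AdU.times AdU.divE AdU.divF)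
qed

lemma AdU_sum: "(\<And>i. i \<in> A \<Longrightarrow> f i \<in> AdU) \<Longrightarrow> sum f A \<in> AdU"
  by (induction A rule: infinite_finite_induct) (auto intro: AdU.zero AdU.plus)

lemma EF_sum_AdU: "(\<And>c a. f c a \<in> laurent_ints) \<Longrightarrow> EF_sum w n f \<in> AdU"
  unfolding EF_sum_def by (auto intro!: AdU_sum AdU.scale EF_vec_AdU)

lemma idiv_odd_AdU: "idiv_odd n \<rhd> idem (2 * l - 1) \<in> AdU"
proof (cases "even n")
  case True
  then obtain m where n: "n = 2 * m" by blast
  show ?thesis unfolding n idiv_odd_even_expansion
    by (intro EF_sum_AdU) (simp add: even_coeff_def laurent_ints_powi_mult qbinom2_laurent_ints)
next
  case False
  then obtain m where n: "n = 2 * m + 1" by (elim oddE)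
  show ?thesis unfolding n idiv_odd_odd_expansion
    by (intro EF_sum_AdU) (simp add: odd_coeff_def laurent_ints_powi_mult qbinom2_laurent_ints)
qed

lemma act_idem_AdU_odd:
  assumes "x \<rhd> idem (2 * l - 1) \<in> AdU"
  shows "x \<rhd> idem (2 * l - 1) \<in> AdU_odd"
proof -
  have "x \<rhd> idem (2 * l - 1) = (\<Sum>k\<in>{l}. (x \<rhd> idem (2 * l - 1)) * idem (2 * k - 1))"
    by (simp add: dU_relations flip: act_module(7))
  then show ?thesis
    unfolding AdU_odd_def using assms
    by (intro CollectI exI[of _ "{l}"] exI[of _ "\<lambda>_. x \<rhd> idem (2 * l - 1)"]) simp
qed

theorem proposition3p5:
  fixes m n :: nat and l :: int
  shows
    "idiv_odd (2 * m) \<rhd> idem (2 * l - 1) =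
       (\<Sum>c = 0..m. \<Sum>a = 0..2 * m - 2 * c.
          (qq powi (2 * (int a + int c) * (int m - int a - l) - 2 * int a * int c + int a
                    - int ((2 * c) choose 2))
            * qbinom2 (int m - int c - int a - l) c)
          *\<^sub>q ((divE a * divF (2 * m - 2 * c - a)) \<rhd> idem (2 * l - 1)))
     \<and> idiv_odd (2 * m + 1) \<rhd> idem (2 * l - 1) =
       (\<Sum>c = 0..m. \<Sum>a = 0..2 * m + 1 - 2 * c.
          (qq powi (2 * (int a + int c) * (int m - int a - l) - 2 * int a * int c + 2 * int a
                    - int ((2 * c) choose 2))
            * qbinom2 (int m - int c - int a - l + 1) c)
          *\<^sub>q ((divE a * divF (2 * m + 1 - 2 * c - a)) \<rhd> idem (2 * l - 1)))
     \<and> idiv_odd n \<rhd> idem (2 * l - 1) \<in> AdU_odd"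
  using idiv_odd_even_expansion[of m l] idiv_odd_odd_expansion[of m l]
    act_idem_AdU_odd[OF idiv_odd_AdU, of n l]
  unfolding EF_sum_def sum_tri EF_vec_def even_coeff_def odd_coeff_def by simp

end
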